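(* Let $N, d \ge 1$ be integers, let $\mathbf{c}_1, \dots, \mathbf{c}_N \in \mathbb{R}^d$ be vectors with $\|\mathbf{c}_i\|_2 = 1$ for every $i$, and let $\mathbf{CLS} \in \mathbb{R}^{N \times d}$ be the matrix whose $i$-th row is $\mathbf{c}_i^{\top}$. Let $$\mathcal{A} = \frac{1}{N}\,\mathbf{CLS}^{\top}\mathbf{CLS} = \frac{1}{N}\sum_{i=1}^N \mathbf{c}_i \mathbf{c}_i^{\top} \in \mathbb{R}^{d \times d},$$ let $k \le d$ be the rank of $\mathcal{A}$, and let $\lambda_1 \ge \lambda_2 \ge \dots \ge \lambda_d$ be the eigenvalues of $\mathcal{A}$ counted with multiplicity. Then $$\log\left(\operatorname{rank}(\mathcal{A})\right) \ge \hat{H}(\mathcal{A}),$$ where $\hat{H}(\mathcal{A})$ is the von Neumann entropy of $\mathcal{A}$. Moreover, equality holds if $\lambda_j = 1/k$ for all $j = 1, \dots, k$ and $\lambda_j = 0$ for all $j = k+1, \dots, d$.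
   Context: For a symmetric positive semidefinite matrix $\mathcal{A} \in \mathbb{R}^{d\times d}$ with eigenvalues $\lambda_1, \dots, \lambda_d$ (counted with multiplicity), the von Neumann entropy is $\hat{H}(\mathcal{A}) = -\sum_{j=1}^d \lambda_j \log \lambda_j$, with $\log$ the natural logarithm and the convention $0 \log 0 = 0$. *)

theory Defs
  imports
    "HOL-Analysis.Analysis"
    "HOL-Computational_Algebra.Computational_Algebra"
begin

definition charpoly :: "real^'n^'n \<Rightarrow> real poly" where
  "charpoly A = det (mat [:0, 1:] - map_matrix (\<lambda>a. [:a:]) A)"

text \<open>The real eigenvalues with their algebraic multiplicities. For a symmetric matrix these
  are all the eigenvalues, and the algebraic and geometric multiplicities agree.\<close>

definition eigenvalues :: "real^'n^'n \<Rightarrow> real multiset" where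
  "eigenvalues A = proots (charpoly A)"

text \<open>Meaningful for symmetric positive semidefinite \<open>A\<close>. The convention
  \<open>0 log 0 = 0\<close> holds automatically because of the factor \<open>0\<close>.\<close>

definition von_neumann_entropy :: "real^'n^'n \<Rightarrow> real" where
  "von_neumann_entropy A = - (\<Sum>x\<in>#eigenvalues A. x * ln x)"

lemma gram_eq_sum_outer_products:
  fixes c :: "'n::finite \<Rightarrow> real^'d"
  defines "CLS \<equiv> (\<chi> i. c i)"
  shows "transpose CLS ** CLS = (\<Sum>i\<in>UNIV. (\<chi> a b. c i $ a * c i $ b))"
  by (simp add: CLS_def vec_eq_iff matrix_matrix_mult_def transpose_def)

lemma poly_charpoly: "poly (charpoly A) x = det (mat x - A)"
proof -
  have "poly (charpoly A) x
      = (\<Sum>p\<in>{p. p permutes UNIV}. of_int (sign p) *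
          (\<Prod>i\<in>UNIV. poly ((mat [:0, 1:] - map_matrix (\<lambda>a. [:a:]) A) $ i $ p i) x))"
    by (simp add: charpoly_def det_def poly_sum poly_prod)
  also have "\<dots> = det (mat x - A)"
    unfolding det_def by (intro sum.cong refl arg_cong2[where f = "(*)"] prod.cong) (auto simp: mat_def)
  finally show ?thesis .
qed

end

theory Submission
  imports Defs
begin

text \<open>
  The spectral theorem, obtained by maximising the Rayleigh quotient on invariant subspaces,
  identifies the roots of the characteristic polynomial with the eigenvalues \<open>l\<^sub>i\<close> of an
  orthonormal eigenbasis. They are nonnegative since \<open>A\<close> is a Gram matrix, they sum to
  the trace, which is \<open>1\<close> because the rows are unit vectors, and the eigenvectors with
  \<open>l\<^sub>i \<noteq> 0\<close> are independent vectors in the range of \<open>A\<close>. Hence the entropy is that of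
  a probability vector with at most \<open>rank A\<close> nonzero entries, and \<open>ln y \<le> y - 1\<close> bounds it by
  \<open>ln (rank A)\<close>.
\<close>

section \<open>Spectral theorem for self-adjoint maps\<close>

text \<open>At a maximiser \<open>u\<close> of \<open>x \<bullet> f x\<close> on the compact unit
  sphere of \<open>S\<close>, moving along the residual \<open>f u - l *\<^sub>R u\<close> would
  increase the Rayleigh quotient to first order unless that residual vanishes.\<close>

lemma selfadjoint_eigenvector_exists:
  fixes f :: "'a::euclidean_space \<Rightarrow> 'a"
  assumes lin: "linear f" and self: "\<And>x y. f x \<bullet> y = x \<bullet> f y"
    and S: "subspace S" and inv: "f ` S \<subseteq> S" and ne: "S \<noteq> {0}"
  shows "\<exists>u\<in>S. norm u = 1 \<and> (\<exists>l. f u = l *\<^sub>R u)"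
proof -
  interpret linear f by (rule lin)
  let ?K = "sphere 0 1 \<inter> S"
  obtain v where v: "v \<in> S" "v \<noteq> 0"
    using ne S subspace_0 by blast
  then have "v /\<^sub>R norm v \<in> ?K"
    using S by (simp add: subspace_scale)
  moreover have "compact ?K"
    using S by (simp add: closed_subspace compact_Int_closed)
  moreover have "continuous_on ?K (\<lambda>x. x \<bullet> f x)"
    using lin by (intro continuous_on_inner continuous_on_id linear_continuous_on)
      (simp add: linear_conv_bounded_linear)
  ultimately obtain u where u: "u \<in> ?K" and max: "\<And>x. x \<in> ?K \<Longrightarrow> x \<bullet> f x \<le> u \<bullet> f u"
    using continuous_attains_sup[of ?K "\<lambda>x. x \<bullet> f x"] by blast
  define l where "l = u \<bullet> f u"
  have le: "x \<bullet> f x \<le> l * (x \<bullet> x)" if "x \<in> S" for x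
  proof (cases "x = 0")
    case False
    then have "x /\<^sub>R norm x \<in> ?K"
      using S that by (simp add: subspace_scale)
    from max[OF this] False show ?thesis
      by (simp add: l_def scale field_simps dot_square_norm power2_eq_square)
  qed simp
  define w where "w = f u - l *\<^sub>R u"
  have w: "w \<in> S"
    unfolding w_def using u inv S by (auto intro!: subspace_diff subspace_scale)
  define C where "C = l * (w \<bullet> w) - w \<bullet> f w"
  have uu: "u \<bullet> u = 1"
    using u by (simp add: dot_square_norm)
  \<comment> \<open>Test the bound \<open>le\<close> at \<open>u + t *\<^sub>R w\<close>: the
    constant terms cancel, the linear ones leave \<open>2 * t * (w \<bullet> w)\<close>, and
    \<open>C\<close> collects the quadratic ones.\<close>
  have key: "2 * t * (w \<bullet> w) \<le> t\<^sup>2 * C" for t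
  proof -
    have "u + t *\<^sub>R w \<in> S"
      using u w S by (auto intro: subspace_add subspace_scale)
    from le[OF this] have "(u + t *\<^sub>R w) \<bullet> (f u + t *\<^sub>R f w) \<le> l * ((u + t *\<^sub>R w) \<bullet> (u + t *\<^sub>R w))"
      by (simp add: add scale)
    moreover have "(u + t *\<^sub>R w) \<bullet> (f u + t *\<^sub>R f w) = l + 2 * t * (w \<bullet> f u) + t\<^sup>2 * (w \<bullet> f w)"
      using self[of u w]
      by (simp add: inner_simps l_def power2_eq_square inner_commute algebra_simps)
    moreover have "l * ((u + t *\<^sub>R w) \<bullet> (u + t *\<^sub>R w)) = l + 2 * t * l * (w \<bullet> u) + t\<^sup>2 * (l * (w \<bullet> w))"
      using uu by (simp add: inner_simps power2_eq_square inner_commute algebra_simps)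
    ultimately have "2 * t * (w \<bullet> f u) + t\<^sup>2 * (w \<bullet> f w) \<le> 2 * t * l * (w \<bullet> u) + t\<^sup>2 * (l * (w \<bullet> w))"
      by linarith
    moreover have "w \<bullet> f u = w \<bullet> w + l * (w \<bullet> u)"
      by (simp add: w_def inner_simps)
    ultimately show ?thesis
      by (simp add: C_def distrib_left right_diff_distrib mult.assoc)
  qed
  have "w \<bullet> w \<le> 0"
  proof (cases "C > 0")
    case True
    \<comment> \<open>This \<open>t\<close> minimises
      \<open>t\<^sup>2 * C - 2 * t * (w \<bullet> w)\<close>. When \<open>C \<le> 0\<close>, already
      \<open>t = 1\<close> suffices.\<close>
    from key[of "(w \<bullet> w) / C"] True have "2 * (w \<bullet> w)\<^sup>2 / C \<le> (w \<bullet> w)\<^sup>2 / C"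
      by (simp add: power2_eq_square)
    with True have "(w \<bullet> w)\<^sup>2 \<le> 0"
      by (simp add: field_simps)
    then show ?thesis by simp
  next
    case False
    with key[of 1] show ?thesis by simp
  qed
  then have "w = 0"
    using inner_gt_zero_iff[of w] by linarith
  then have "f u = l *\<^sub>R u"
    by (simp add: w_def)
  with u show ?thesis by auto
qed

text \<open>Induction on the dimension: split off a unit eigenvector \<open>u\<close>. Its
  orthogonal complement in \<open>S\<close> is again invariant, because
  \<open>u \<bullet> f x = f u \<bullet> x = l * (u \<bullet> x)\<close>.\<close>

lemma selfadjoint_orthonormal_eigenbasis:
  fixes f :: "'a::euclidean_space \<Rightarrow> 'a"
  assumes lin: "linear f" and self: "\<And>x y. f x \<bullet> y = x \<bullet> f y"
    and "subspace S" and "f ` S \<subseteq> S"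
  shows "\<exists>B\<subseteq>S. finite B \<and> card B = dim S \<and> pairwise orthogonal B \<and>
    (\<forall>b\<in>B. norm b = 1 \<and> (\<exists>l. f b = l *\<^sub>R b))"
  using assms(3,4)
proof (induction "dim S" arbitrary: S)
  case 0
  then show ?case
    by (intro exI[of _ "{}"]) auto
next
  case (Suc n)
  then have "S \<noteq> {0}" by auto
  from selfadjoint_eigenvector_exists[OF lin self Suc.prems this]
  obtain u l where u: "u \<in> S" "norm u = 1" "f u = l *\<^sub>R u" by blast
  define T where "T = {x \<in> S. u \<bullet> x = 0}"
  have subT: "subspace T"
    using Suc.prems(1) by (auto simp: T_def subspace_def inner_simps)
  have invT: "f ` T \<subseteq> T"
    using Suc.prems(2) self[of u, symmetric] u(3) by (auto simp: T_def)
  have "T = {y \<in> S. \<forall>x\<in>span {u}. orthogonal x y}"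
    by (auto simp: T_def orthogonal_def span_singleton)
  moreover have "span {u} \<subseteq> S"
    using u Suc.prems(1) by (simp add: span_minimal)
  ultimately have "dim T + dim (span {u}) = dim S"
    using dim_subspace_orthogonal_to_vectors[OF subspace_span Suc.prems(1)] by metis
  moreover have "dim (span {u}) = 1"
    using u by (auto simp: dim_singleton)
  ultimately have "n = dim T"
    using Suc.hyps(2) by simp
  from Suc.hyps(1)[OF this subT invT] obtain B where
    B: "B \<subseteq> T" "finite B" "card B = dim T" "pairwise orthogonal B"
      "\<forall>b\<in>B. norm b = 1 \<and> (\<exists>l. f b = l *\<^sub>R b)" by blast
  have "u \<notin> B"
    using B(1) u(2) by (auto simp: T_def)
  moreover have "pairwise orthogonal (insert u B)"
    using B(1,4) by (auto simp: T_def pairwise_insert orthogonal_def inner_commute)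
  ultimately show ?case
    using B u Suc.hyps(2) \<open>n = dim T\<close>
    by (intro exI[of _ "insert u B"]) (auto simp: T_def)
qed

text \<open>Indexing the basis by \<open>'n\<close> itself lets the eigenvectors serve as the rows
  of a square matrix.\<close>

lemma symmetric_matrix_eigenbasis:
  fixes A :: "real^'n^'n"
  assumes "transpose A = A"
  obtains b l where "\<And>i j. b i \<bullet> b j = (if i = j then 1 else 0)"
    and "\<And>i::'n. A *v b i = l i *\<^sub>R b i"
proof -
  have "(A *v x) \<bullet> y = x \<bullet> (A *v y)" for x y
    by (metis assms dot_lmul_matrix transpose_matrix_vector)
  from selfadjoint_orthonormal_eigenbasis[OF matrix_vector_mul_linear this subspace_UNIV]
  obtain B where B: "finite B" "card B = CARD('n)" "pairwise orthogonal B"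
    "\<forall>b\<in>B. norm b = 1 \<and> (\<exists>l. A *v b = l *\<^sub>R b)"
    by auto
  then obtain b :: "'n \<Rightarrow> real^'n" where b: "bij_betw b UNIV B"
    by (metis finite_same_card_bij finite)
  have "\<forall>i. \<exists>l. A *v b i = l *\<^sub>R b i"
    using B(4) b by (auto simp: bij_betw_def)
  then obtain l where l: "\<And>i. A *v b i = l i *\<^sub>R b i" by metis
  have "b i \<bullet> b j = (if i = j then 1 else 0)" for i j
    using B(3,4) b by (auto simp: bij_betw_def pairwise_def orthogonal_def inj_eq norm_eq_1)
  with l show ?thesis using that by blast
qed

section \<open>Spectrum, trace and rank from an orthonormal eigenbasis\<close>

text \<open>The entry of \<open>Q ** M ** transpose Q\<close> at \<open>i\<close>, \<open>j\<close>
  is \<open>b i \<bullet> (M *v b j)\<close>; take \<open>M = A\<close> and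
  \<open>M = mat 1\<close>.\<close>

lemma eigenbasis_conjugation:
  fixes A :: "real^'n^'n"
  assumes b: "\<And>i j. b i \<bullet> b j = (if i = j then 1 else 0)"
    and l: "\<And>i::'n. A *v b i = l i *\<^sub>R b i"
  defines "Q \<equiv> \<chi> i. b i"
  shows "Q ** A ** transpose Q = (\<chi> i j. if i = j then l i else 0)"
    and "Q ** transpose Q = mat 1" and "transpose Q ** Q = mat 1"
proof -
  have entry: "(Q ** M ** transpose Q) $ i $ j = b i \<bullet> (M *v b j)" for M i j
    unfolding matrix_mul_assoc[symmetric]
    by (simp add: Q_def matrix_matrix_mult_def transpose_def matrix_vector_mult_def inner_vec_def)
  show "Q ** A ** transpose Q = (\<chi> i j. if i = j then l i else 0)"
    by (simp add: vec_eq_iff entry l b)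
  show "Q ** transpose Q = mat 1"
    using entry[of "mat 1"] by (simp add: vec_eq_iff b) (simp add: mat_def)
  then show "transpose Q ** Q = mat 1"
    by (simp add: matrix_left_right_inverse)
qed

text \<open>Orthogonal conjugation preserves the determinant, so the characteristic polynomial
  agrees at every real \<open>x\<close> with a product of linear factors and hence equals
  it.\<close>

lemma eigenvalues_eigenbasis:
  fixes A :: "real^'n^'n"
  assumes b: "\<And>i j. b i \<bullet> b j = (if i = j then 1 else 0)"
    and l: "\<And>i::'n. A *v b i = l i *\<^sub>R b i"
  shows "eigenvalues A = image_mset l (mset_set UNIV)"
proof -
  define Q :: "real^'n^'n" where "Q = (\<chi> i. b i)"
  have "poly (charpoly A) x = (\<Prod>i\<in>UNIV. x - l i)" for x
  proof -
    have "(mat x - A) *v b i = (x - l i) *\<^sub>R b i" for i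
    proof -
      have "mat x *v b i = x *\<^sub>R b i"
        by (simp add: vec_eq_iff matrix_vector_mult_def mat_def if_distrib[of "\<lambda>y. y * _"] cong: if_cong)
      then show ?thesis
        by (simp add: matrix_vector_mult_diff_rdistrib l scaleR_left_diff_distrib)
    qed
    \<comment> \<open>The conjugation is applied to \<open>mat x - A\<close>, which has the same
      eigenvectors with eigenvalues \<open>x - l i\<close>.\<close>
    note Q = eigenbasis_conjugation[OF b this, folded Q_def]
    have "det (mat x - A) = det (mat x - A) * det (Q ** transpose Q)"
      by (simp add: Q)
    also have "\<dots> = det (Q ** (mat x - A) ** transpose Q)"
      by (simp add: det_mul)
    also have "\<dots> = (\<Prod>i\<in>UNIV. x - l i)"
      unfolding Q by (subst det_diagonal) auto
    finally show ?thesis by (simp add: poly_charpoly)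
  qed
  then have "charpoly A = (\<Prod>i\<in>UNIV. [:- l i, 1:])"
    by (auto simp: poly_eq_poly_eq_iff[symmetric] poly_prod fun_eq_iff)
  then show ?thesis
    by (simp add: eigenvalues_def proots_prod sum_unfold_sum_mset)
qed

text \<open>The trace is cyclic, hence unchanged when \<open>A\<close> is diagonalised by
  \<open>Q\<close>.\<close>

lemma sum_eigenbasis_eq_trace:
  fixes A :: "real^'n^'n"
  assumes b: "\<And>i j. b i \<bullet> b j = (if i = j then 1 else 0)"
    and l: "\<And>i::'n. A *v b i = l i *\<^sub>R b i"
  shows "(\<Sum>i\<in>UNIV. l i) = trace A"
proof -
  define Q :: "real^'n^'n" where "Q = (\<chi> i. b i)"
  note Q = eigenbasis_conjugation[OF assms, folded Q_def]
  have "(\<Sum>i\<in>UNIV. l i) = trace (Q ** A ** transpose Q)"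
    by (simp add: Q trace_def)
  also have "\<dots> = trace (transpose Q ** Q ** A)"
    by (metis trace_mul_sym matrix_mul_assoc)
  also have "\<dots> = trace A"
    by (simp add: Q)
  finally show ?thesis .
qed

lemma card_nonzero_eigenvalues_le_rank:
  fixes A :: "real^'n^'n"
  assumes b: "\<And>i j. b i \<bullet> b j = (if i = j then 1 else 0)"
    and l: "\<And>i::'n. A *v b i = l i *\<^sub>R b i"
  shows "card {i. l i \<noteq> 0} \<le> rank A"
proof -
  let ?I = "{i. l i \<noteq> 0}"
  have "inj b"
    by (rule injI) (metis b zero_neq_one)
  then have card: "card (b ` ?I) = card ?I"
    by (meson card_image inj_on_subset subset_UNIV)
  have "pairwise orthogonal (b ` ?I)"
    by (auto simp: pairwise_def orthogonal_def b)
  moreover have "0 \<notin> b ` ?I"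
    by (metis b imageE inner_zero_left zero_neq_one)
  ultimately have "independent (b ` ?I)"
    by (rule pairwise_orthogonal_independent)
  moreover have "b ` ?I \<subseteq> range ((*v) A)"
  proof
    fix x assume "x \<in> b ` ?I"
    then obtain i where i: "x = b i" "l i \<noteq> 0" by auto
    \<comment> \<open>Dividing by the nonzero eigenvalue exhibits a preimage of the
      eigenvector.\<close>
    then have "x = A *v (b i /\<^sub>R l i)"
      by (simp add: matrix_vector_mult_scaleR l)
    then show "x \<in> range ((*v) A)" by blast
  qed
  ultimately have "card (b ` ?I) \<le> dim (range ((*v) A))"
    by (simp add: independent_card_le_dim)
  then show ?thesis
    by (simp add: card rank_dim_range)
qed

section \<open>Entropy estimates and conclusion\<close>

text \<open>Gibbs' inequality against the uniform distribution on the support. Positivity of the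
  support size later permits monotonicity of \<open>ln\<close> when passing to the rank.\<close>

lemma entropy_le_ln_card_support:
  fixes p :: "'a::finite \<Rightarrow> real"
  assumes nonneg: "\<And>i. p i \<ge> 0" and sum: "(\<Sum>i\<in>UNIV. p i) = 1"
  shows "- (\<Sum>i\<in>UNIV. p i * ln (p i)) \<le> ln (real (card {i. p i \<noteq> 0}))"
    and "card {i. p i \<noteq> 0} > 0"
proof -
  let ?I = "{i. p i \<noteq> 0}"
  define m where "m = real (card ?I)"
  have sumI: "(\<Sum>i\<in>?I. p i) = 1"
    using sum by (subst sum.mono_neutral_left[of UNIV]) auto
  then have "?I \<noteq> {}" by (metis sum.empty zero_neq_one)
  then show pos: "card ?I > 0"
    by (simp add: card_gt_0_iff)
  then have m: "m > 0" by (simp add: m_def)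
  \<comment> \<open>Since the \<open>p i\<close> sum to 1, \<open>ln m\<close> can be spread over
    the summands with weights \<open>p i\<close>.\<close>
  have "- (\<Sum>i\<in>UNIV. p i * ln (p i)) - ln m = (\<Sum>i\<in>?I. - (p i * ln (p i))) - (\<Sum>i\<in>?I. p i) * ln m"
    unfolding sumI by (subst sum.mono_neutral_right[of UNIV ?I]) (auto simp: sum_negf)
  also have "\<dots> = (\<Sum>i\<in>?I. - (p i * ln (p i)) - p i * ln m)"
    by (simp add: sum_subtractf sum_distrib_right)
  also have "\<dots> \<le> (\<Sum>i\<in>?I. 1 / m - p i)"
  proof (rule sum_mono)
    fix i assume "i \<in> ?I"
    then have p: "p i > 0" using nonneg[of i] by simp
    have "- (p i * ln (p i)) - p i * ln m = p i * ln (1 / (m * p i))"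
      using p m by (simp add: ln_div ln_mult algebra_simps)
    \<comment> \<open>This is \<open>ln y \<le> y - 1\<close> at \<open>y = 1 / (m * p i)\<close>,
      the ratio of the uniform weight to \<open>p i\<close>.\<close>
    also have "\<dots> \<le> p i * (1 / (m * p i) - 1)"
      using p m by (intro mult_left_mono ln_le_minus_one) auto
    also have "\<dots> = 1 / m - p i"
      using p m by (simp add: field_simps)
    finally show "- (p i * ln (p i)) - p i * ln m \<le> 1 / m - p i" .
  qed
  also have "\<dots> = 0"
    using m by (simp add: sum_subtractf sumI flip: m_def)
  finally show "- (\<Sum>i\<in>UNIV. p i * ln (p i)) \<le> ln (real (card ?I))"
    by (simp add: m_def)
qed

lemma von_neumann_entropy_uniform:
  fixes A :: "real^'d^'d"
  assumes "image_mset lam (mset_set {1..CARD('d)}) = eigenvalues A"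
    and "k \<le> CARD('d)"
    and "\<forall>j\<in>{1..k}. lam j = 1 / real k" and "\<forall>j\<in>{k+1..CARD('d)}. lam j = 0"
  shows "von_neumann_entropy A = ln (real k)"
proof -
  have "von_neumann_entropy A = - (\<Sum>j\<in>{1..CARD('d)}. lam j * ln (lam j))"
    by (simp add: von_neumann_entropy_def assms(1)[symmetric] sum_unfold_sum_mset
        image_mset.compositionality comp_def)
  also have "(\<Sum>j\<in>{1..CARD('d)}. lam j * ln (lam j)) = (\<Sum>j\<in>{1..k}. lam j * ln (lam j))"
    using assms(2,4) by (intro sum.mono_neutral_right) auto
  also have "\<dots> = (\<Sum>j\<in>{1..k}. 1 / real k * ln (1 / real k))"
    using assms(3) by (intro sum.cong) auto
  \<comment> \<open>For \<open>k = 0\<close> the sum is empty and \<open>ln 0 = 0\<close> in HOL;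
    otherwise \<open>k\<close> equal terms add up.\<close>
  also have "\<dots> = - ln (real k)"
    by (cases "k = 0") (auto simp: ln_div)
  finally show ?thesis by simp
qed

theorem theorem1:
  fixes c :: "'n::finite \<Rightarrow> real^'d"
    and CLS :: "real^'d^'n"
    and A :: "real^'d^'d"
    and k :: nat
  assumes unit: "\<And>i. norm (c i) = 1"
    and CLS: "CLS = (\<chi> i. c i)"
    and A: "A = (1 / real CARD('n)) *\<^sub>R (transpose CLS ** CLS)"
    and k: "k = rank A"
  shows "ln (real (rank A)) \<ge> von_neumann_entropy A \<and>
    (\<forall>lam :: nat \<Rightarrow> real.
      antimono_on {1..CARD('d)} lam \<longrightarrow>
      image_mset lam (mset_set {1..CARD('d)}) = eigenvalues A \<longrightarrow>
      (\<forall>j\<in>{1..k}. lam j = 1 / real k) \<longrightarrow>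
      (\<forall>j\<in>{k+1..CARD('d)}. lam j = 0) \<longrightarrow>
      ln (real (rank A)) = von_neumann_entropy A)"
proof (intro conjI allI impI)
  have "transpose A = A"
    by (simp add: A transpose_scalar matrix_transpose_mul)
  then obtain b l where b: "\<And>i j. b i \<bullet> b j = (if i = j then 1 else 0)"
    and l: "\<And>i::'d. A *v b i = l i *\<^sub>R b i"
    by (rule symmetric_matrix_eigenbasis) blast
  have nonneg: "l i \<ge> 0" for i
  proof -
    \<comment> \<open>The eigenvalue is the Rayleigh quotient at the unit vector \<open>b i\<close>,
      which for a Gram matrix is a scaled squared norm.\<close>
    have "l i = b i \<bullet> (A *v b i)"
      by (simp add: l b)
    also have "\<dots> = (1 / real CARD('n)) * ((CLS *v b i) \<bullet> (CLS *v b i))"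
      by (simp add: A scaleR_matrix_vector_assoc[symmetric] matrix_vector_mul_assoc[symmetric]
          dot_lmul_matrix transpose_matrix_vector inner_commute[of "b i"])
    finally show ?thesis by simp
  qed
  \<comment> \<open>Swapping the double sum groups the squared entries of \<open>CLS\<close> by
    rows, that is, into the squared norms of the \<open>c i\<close>.\<close>
  have "trace A = (1 / real CARD('n)) * (\<Sum>i\<in>UNIV. c i \<bullet> c i)"
    unfolding A CLS trace_def
    by (simp add: matrix_matrix_mult_def transpose_def inner_vec_def sum_divide_distrib[symmetric])
      (rule sum.swap)
  also have "\<dots> = 1"
    using unit by (simp add: norm_eq_1)
  finally have sum: "(\<Sum>i\<in>UNIV. l i) = 1"
    using sum_eigenbasis_eq_trace[OF b l] by simp
  have "von_neumann_entropy A = - (\<Sum>i\<in>UNIV. l i * ln (l i))"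
    by (simp add: von_neumann_entropy_def eigenvalues_eigenbasis[OF b l] sum_unfold_sum_mset
        image_mset.compositionality comp_def)
  also have "\<dots> \<le> ln (real (card {i. l i \<noteq> 0}))"
    by (rule entropy_le_ln_card_support[OF nonneg sum])
  also have "\<dots> \<le> ln (real (rank A))"
    using entropy_le_ln_card_support(2)[OF nonneg sum] card_nonzero_eigenvalues_le_rank[OF b l]
    by (simp add: ln_mono)
  finally show "ln (real (rank A)) \<ge> von_neumann_entropy A" .
next
  \<comment> \<open>The rank bound keeps \<open>{1..k}\<close> inside the index range of
    \<open>lam\<close>.\<close>
  have "k \<le> CARD('d)"
    using rank_bound[of A] k by simp
  then show "ln (real (rank A)) = von_neumann_entropy A"
    if "image_mset lam (mset_set {1..CARD('d)}) = eigenvalues A"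
      and "\<forall>j\<in>{1..k}. lam j = 1 / real k" and "\<forall>j\<in>{k+1..CARD('d)}. lam j = 0" for lam
    using von_neumann_entropy_uniform[OF that(1) _ that(2,3)] k by simp
qed

end
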